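(* Let $\Omega\subseteq\mathbb{R}^n$ be a nonempty, closed, convex and bounded set. Let $J$ be continuously differentiable and strongly convex on $\Omega$ with parameter $\mu>0$, let $\nabla J$ be Lipschitz continuous on $\Omega$ with constant $L\ge\mu$, and assume there is at least one point $x_\Omega\in\Omega$ with $\|\nabla J(x_\Omega)\|<+\infty$. Let $\{\tau_k\}_{k=0}^\infty$ be positive scalars with $0<\inf_k\tau_k\le\tau_k\le\sup_k\tau_k<2/L$. Let the diagonal scaling matrices $D(x)$ be either of the form $$D(x)\equiv\operatorname{diag}\{1/s_j\}_{j=1}^n\ \text{ with } s_j\in\mathbb{R},\ s_j>0,\ j=1,\ldots,n,$$ or of the form $$D(x)=\operatorname{diag}\{x_j/\hat s_j\}_{j=1}^n\ \text{ with } \hat s_j\in\mathbb{R},\ \hat s_j>0,\ j=1,\ldots,n .$$ Let $\{v^k\}_{k=0}^\infty\subset\mathbb{R}^n$ be bounded and let $\{\beta_k\}_{k=0}^\infty$ satisfy $\beta_k\ge0$ for all $k\ge0$ and $\sum_{k=0}^\infty\beta_k<\infty$. Then, for any $x^0\in\Omega$, any sequence $\{x^k\}_{k=0}^\infty$ generated by $$x^{k+1}=P_\Omega\big((x^k+\beta_kv^k)-\tau_kD(x^k+\beta_kv^k)\nabla J(x^k+\beta_kv^k)\big),\qquad k\ge0,$$ such that $x^k+\beta_kv^k\in\Omega$ for all $k\ge0$, and for which $\theta^k:=\nabla J(x^k)-D(x^k)\nabla J(x^k)$ satisfies $\sum_{k=0}^\infty\|\theta^k\|<+\infty$, converges to a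 point of $S$.
   Context: $\|\cdot\|$ is the Euclidean norm, $\langle\cdot,\cdot\rangle$ the standard inner product, and $P_\Omega$ the orthogonal (Euclidean) projection onto $\Omega$. $J:\Omega\to\mathbb{R}$ has gradient $\nabla J(x)$ defined for $x\in\Omega$ ($J$ is continuously differentiable on an open neighbourhood of $\Omega$). Lipschitz continuity of $\nabla J$ with constant $L$ on $\Omega$: $\|\nabla J(x)-\nabla J(y)\|\le L\|x-y\|$ for all $x,y\in\Omega$. Strong convexity with parameter $\mu$ on $\Omega$: $J(y)\ge J(x)+\langle\nabla J(x),y-x\rangle+\frac12\mu\|y-x\|^2$ for all $x,y\in\Omega$. The residual function is $r(x):=x-P_\Omega(x-\nabla J(x))$ and the set of stationary points is $S:=\{x: r(x)=0\}$ (such points necessarily lie in $\Omega$). Standing assumption: $S\ne\emptyset$. The numbers $s_j$, $\hat s_j$ are fixed constants independent of $x$ and $k$. *)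

theory Defs
  imports "HOL-Analysis.Analysis"
begin

definition diag_matrix :: "real ^ 'n \<Rightarrow> real ^ 'n ^ 'n" where
  "diag_matrix d = (\<chi> i j. if i = j then d $ i else 0)"

(* The gradient of J is passed explicitly as g; that g really is the gradient of J is part of
   C1_near, whose open set U makes the gradient on Omega unique even if Omega has empty interior. *)
definition C1_near :: "(real ^ 'n) set \<Rightarrow> (real ^ 'n \<Rightarrow> real) \<Rightarrow> (real ^ 'n \<Rightarrow> real ^ 'n) \<Rightarrow> bool" where
  "C1_near \<Omega> J g \<longleftrightarrow>
     (\<exists>U. open U \<and> \<Omega> \<subseteq> U \<and> (\<forall>x\<in>U. GDERIV J x :> g x) \<and> continuous_on U g)"

definition strongly_convex_grad ::
    "real \<Rightarrow> (real ^ 'n) set \<Rightarrow> (real ^ 'n \<Rightarrow> real) \<Rightarrow> (real ^ 'n \<Rightarrow> real ^ 'n) \<Rightarrow> bool" where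
  "strongly_convex_grad \<mu> \<Omega> J g \<longleftrightarrow>
     (\<forall>x\<in>\<Omega>. \<forall>y\<in>\<Omega>. J y \<ge> J x + inner (g x) (y - x) + 1 / 2 * \<mu> * (norm (y - x))\<^sup>2)"

definition residual :: "(real ^ 'n) set \<Rightarrow> (real ^ 'n \<Rightarrow> real ^ 'n) \<Rightarrow> real ^ 'n \<Rightarrow> real ^ 'n" where
  "residual \<Omega> g x = x - closest_point \<Omega> (x - g x)"

(* For closed nonempty Omega every zero of the residual lies in Omega, being a value of the
   projection, so the values of g outside Omega do not matter. *)
definition stationary_points :: "(real ^ 'n) set \<Rightarrow> (real ^ 'n \<Rightarrow> real ^ 'n) \<Rightarrow> (real ^ 'n) set" where
  "stationary_points \<Omega> g = {x. residual \<Omega> g x = 0}"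

definition constant_scaling :: "(real ^ 'n \<Rightarrow> real ^ 'n ^ 'n) \<Rightarrow> bool" where
  "constant_scaling D \<longleftrightarrow>
     (\<exists>s :: real ^ 'n. (\<forall>j. s $ j > 0) \<and> (\<forall>x. D x = diag_matrix (\<chi> j. 1 / s $ j)))"

definition linear_scaling :: "(real ^ 'n \<Rightarrow> real ^ 'n ^ 'n) \<Rightarrow> bool" where
  "linear_scaling D \<longleftrightarrow>
     (\<exists>s :: real ^ 'n. (\<forall>j. s $ j > 0) \<and> (\<forall>x. D x = diag_matrix (\<chi> j. x $ j / s $ j)))"

end

theory Submission
  imports Defs
begin

text \<open>
  The iteration is an inexact projected gradient method. Write \<open>y\<^sub>k = x\<^sub>k + \<beta>\<^sub>k v\<^sub>k\<close> and let
  \<open>e\<^sub>k = D(y\<^sub>k) \<nabla>J(y\<^sub>k) - \<nabla>J(y\<^sub>k)\<close>, so that \<open>x\<^sub>k\<^sub>+\<^sub>1\<close> is the projection of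
  \<open>y\<^sub>k - \<tau>\<^sub>k (\<nabla>J(y\<^sub>k) + e\<^sub>k)\<close>. For both kinds of scaling the map \<open>x \<mapsto> D(x) \<nabla>J(x)\<close> is Lipschitz on the
  bounded set \<open>\<Omega>\<close>, hence \<open>e\<^sub>k\<close> differs from \<open>-\<theta>\<^sub>k\<close> by \<open>O(\<beta>\<^sub>k)\<close>, and \<open>\<Sum>\<^sub>k \<parallel>e\<^sub>k\<parallel> < \<infinity>\<close>.

  Convergence does not come from contraction of the gradient step: for step sizes up to \<open>2/L\<close> that
  would need cocoercivity of the gradient, and a gradient that is Lipschitz only on \<open>\<Omega>\<close> need not be
  cocoercive with constant \<open>1/L\<close>. The objective serves as a Lyapunov function instead. The descent
  inequality and the variational characterisation of the projection give
  \[ J(x_{k+1}) + c \|x_{k+1} - y_k\|^2 \le J(x_k) + \varepsilon_k,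
     \qquad c = 1/\sup_k\tau_k - L/2 > 0, \qquad \sum_k \varepsilon_k < \infty, \]
  (\<open>projected_step_decrease\<close>). Since \<open>J\<close> is bounded below on \<open>\<Omega>\<close> by its value at a stationary point
  \<open>z\<close>, summing shows \<open>\<Sum>\<^sub>k \<parallel>x\<^sub>k\<^sub>+\<^sub>1 - y\<^sub>k\<parallel>\<^sup>2 < \<infinity>\<close> (\<open>summable_of_perturbed_descent\<close>).
  Finally, strong convexity supplies an error bound (\<open>projected_step_error_bound\<close>): the distance from
  \<open>x\<^sub>k\<^sub>+\<^sub>1\<close> to \<open>z\<close> is at most a constant times \<open>\<parallel>x\<^sub>k\<^sub>+\<^sub>1 - y\<^sub>k\<parallel> + \<parallel>e\<^sub>k\<parallel>\<close>, which tends to \<open>0\<close>.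
\<close>

section \<open>Diagonal scalings\<close>

lemma diag_matrix_mult_vec:
  fixes d u :: "real ^ 'n"
  shows "diag_matrix d *v u = d * u"
  by (simp add: diag_matrix_def matrix_vector_mult_def vec_eq_iff if_distrib if_distribR
      cong: if_cong)

lemma norm_vec_mult_le:
  fixes a b :: "real ^ 'n"
  shows "norm (a * b) \<le> norm a * norm b"
proof -
  have "norm (a * b) \<le> norm (norm a *\<^sub>R b)"
    by (rule norm_le_componentwise_cart)
      (simp add: abs_mult mult_right_mono component_le_norm_cart)
  then show ?thesis by simp
qed

text \<open>A linear map and a constant map are both Lipschitz and bounded on a bounded set, and a product of
  bounded Lipschitz maps is Lipschitz; boundedness is essential for linear scaling, where
  \<open>x \<mapsto> D(x) \<nabla>J(x)\<close> can grow quadratically.\<close>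

lemma scaled_map_lipschitz:
  fixes \<Omega> :: "(real ^ 'n) set" and g :: "real ^ 'n \<Rightarrow> real ^ 'n"
  assumes bdd: "bounded \<Omega>" and lip: "L-lipschitz_on \<Omega> g"
    and D: "constant_scaling D \<or> linear_scaling D"
  obtains C where "C-lipschitz_on \<Omega> (\<lambda>x. D x *v g x)"
proof -
  obtain d A B where d: "\<And>x u. D x *v u = d x * u"
    and A: "A \<ge> 0" "\<And>x. x \<in> \<Omega> \<Longrightarrow> norm (d x) \<le> A"
    and B: "B \<ge> 0" "\<And>x y. norm (d x - d y) \<le> B * norm (x - y)"
    using D
  proof
    assume "constant_scaling D"
    then obtain s :: "real ^ 'n" where "\<And>x. D x = diag_matrix (\<chi> j. 1 / s $ j)"
      unfolding constant_scaling_def by blast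
    then show thesis
      by (intro that[of "\<lambda>_. (\<chi> j. 1 / s $ j)" "norm (\<chi> j. 1 / s $ j)" 0])
        (auto simp: diag_matrix_mult_vec)
  next
    assume "linear_scaling D"
    then obtain s :: "real ^ 'n" where s: "\<And>x. D x = diag_matrix (\<chi> j. x $ j / s $ j)"
      unfolding linear_scaling_def by blast
    define r :: "real ^ 'n" where "r = (\<chi> j. 1 / s $ j)"
    have r: "(\<chi> j. x $ j / s $ j) = x * r" for x
      by (simp add: r_def vec_eq_iff)
    obtain R where R: "R > 0" "\<And>x. x \<in> \<Omega> \<Longrightarrow> norm x \<le> R"
      using bdd unfolding bounded_pos by blast
    show thesis
    proof (rule that[of "\<lambda>x. x * r" "R * norm r" "norm r"])
      show "norm (x * r) \<le> R * norm r" if "x \<in> \<Omega>" for x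
        using norm_vec_mult_le[of x r] R(2)[OF that] mult_right_mono[of "norm x" R "norm r"]
        by simp
      show "norm (x * r - y * r) \<le> norm r * norm (x - y)" for x y
        using norm_vec_mult_le[of "x - y" r] by (simp only: left_diff_distrib mult.commute[of "norm r"])
    qed (use R in \<open>auto simp: s r diag_matrix_mult_vec\<close>)
  qed
  have L: "L \<ge> 0" "\<And>x y. x \<in> \<Omega> \<Longrightarrow> y \<in> \<Omega> \<Longrightarrow> norm (g x - g y) \<le> L * norm (x - y)"
    using lip by (auto simp: lipschitz_on_def dist_norm)
  have "bounded (g ` \<Omega>)"
    using bdd lip by (intro bounded_uniformly_continuous_image lipschitz_on_uniformly_continuous)
  then obtain G where G: "G > 0" "\<And>x. x \<in> \<Omega> \<Longrightarrow> norm (g x) \<le> G"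
    unfolding bounded_pos by blast
  have "(A * L + B * G)-lipschitz_on \<Omega> (\<lambda>x. D x *v g x)"
  proof (rule lipschitz_onI)
    fix x y assume xy: "x \<in> \<Omega>" "y \<in> \<Omega>"
    have "D x *v g x - D y *v g y = d x * (g x - g y) + (d x - d y) * g y"
      by (simp add: d algebra_simps)
    also have "norm \<dots> \<le> norm (d x) * norm (g x - g y) + norm (d x - d y) * norm (g y)"
      by (intro order_trans[OF norm_triangle_ineq] add_mono norm_vec_mult_le)
    also have "\<dots> \<le> A * (L * norm (x - y)) + (B * norm (x - y)) * G"
      using xy A B G L by (intro add_mono mult_mono) auto
    finally show "dist (D x *v g x) (D y *v g y) \<le> (A * L + B * G) * dist x y"
      by (simp add: dist_norm algebra_simps)
  qed (use A B G L in simp)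
  then show thesis by (rule that)
qed

section \<open>Convexity and smoothness of the objective\<close>

text \<open>The variational characterisation of the projection of \<open>z - g z\<close> onto \<open>\<Omega>\<close> becomes the first-order
  optimality condition when that projection is \<open>z\<close> itself.\<close>

lemma stationary_point_optimality:
  assumes "\<Omega> \<noteq> {}" "closed \<Omega>" "convex \<Omega>" and z: "z \<in> stationary_points \<Omega> g"
  shows "z \<in> \<Omega>" and "y \<in> \<Omega> \<Longrightarrow> 0 \<le> inner (g z) (y - z)"
proof -
  have eq: "closest_point \<Omega> (z - g z) = z"
    using z by (simp add: stationary_points_def residual_def)
  then show "z \<in> \<Omega>"
    using closest_point_in_set[of \<Omega> "z - g z"] assms by simp
  show "0 \<le> inner (g z) (y - z)" if "y \<in> \<Omega>"
    using closest_point_dot[of \<Omega> y "z - g z"] assms that by (simp add: eq)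
qed

lemma strongly_convex_grad_monotone:
  assumes "strongly_convex_grad \<mu> \<Omega> J g" and "x \<in> \<Omega>" "y \<in> \<Omega>"
  shows "\<mu> * (norm (x - y))\<^sup>2 \<le> inner (g x - g y) (x - y)"
proof -
  have "J y \<ge> J x + inner (g x) (y - x) + 1 / 2 * \<mu> * (norm (y - x))\<^sup>2"
    and "J x \<ge> J y + inner (g y) (x - y) + 1 / 2 * \<mu> * (norm (x - y))\<^sup>2"
    using assms unfolding strongly_convex_grad_def by blast+
  then show ?thesis
    by (simp add: norm_minus_commute inner_diff_left inner_diff_right)
qed

text \<open>The quadratic upper bound holds with a gradient that is Lipschitz on \<open>\<Omega>\<close> only, because by convexity
  the segment along which the derivative of \<open>J\<close> is estimated stays in \<open>\<Omega>\<close>.\<close>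

lemma descent_inequality:
  fixes J :: "real ^ 'n \<Rightarrow> real"
  assumes C1: "C1_near \<Omega> J g" and "convex \<Omega>" and lip: "L-lipschitz_on \<Omega> g"
    and x: "x \<in> \<Omega>" and y: "y \<in> \<Omega>"
  shows "J y \<le> J x + inner (g x) (y - x) + L / 2 * (norm (y - x))\<^sup>2"
proof -
  define d where "d = y - x"
  define \<phi> where "\<phi> = (\<lambda>t. J (x + t *\<^sub>R d) - t * inner (g x) d - L / 2 * t\<^sup>2 * (norm d)\<^sup>2)"
  have seg: "x + t *\<^sub>R d \<in> \<Omega>" if "0 \<le> t" "t \<le> 1" for t
    using convexD_alt[OF \<open>convex \<Omega>\<close> x y that] by (simp add: d_def algebra_simps)
  have "\<phi> 1 \<le> \<phi> 0"
  proof (rule DERIV_nonpos_imp_nonincreasing[OF zero_le_one], intro exI conjI)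
    fix t :: real assume t: "0 \<le> t" "t \<le> 1"
    have "GDERIV J (x + t *\<^sub>R d) :> g (x + t *\<^sub>R d)"
      using C1 seg[OF t] unfolding C1_near_def by blast
    then have "(J has_derivative (\<lambda>h. inner h (g (x + t *\<^sub>R d)))) (at (x + t *\<^sub>R d))"
      by (simp add: gderiv_def)
    moreover have "((\<lambda>t. x + t *\<^sub>R d) has_derivative (\<lambda>h. h *\<^sub>R d)) (at t)"
      by (auto intro!: derivative_eq_intros)
    ultimately have "((\<lambda>t. J (x + t *\<^sub>R d)) has_derivative
        (\<lambda>h. inner (h *\<^sub>R d) (g (x + t *\<^sub>R d)))) (at t)"
      by (rule has_derivative_compose[rotated])
    then have "((\<lambda>t. J (x + t *\<^sub>R d)) has_real_derivative inner (g (x + t *\<^sub>R d)) d) (at t)"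
      by (rule has_derivative_imp_has_field_derivative) (simp add: inner_commute)
    then show "(\<phi> has_real_derivative
        inner (g (x + t *\<^sub>R d) - g x) d - L * t * (norm d)\<^sup>2) (at t)"
      unfolding \<phi>_def by (auto intro!: derivative_eq_intros simp: inner_diff_left)
    have "norm (g (x + t *\<^sub>R d) - g x) \<le> L * (t * norm d)"
      using lipschitz_onD[OF lip seg[OF t] x] t by (simp add: dist_norm)
    then have "norm (g (x + t *\<^sub>R d) - g x) * norm d \<le> L * (t * norm d) * norm d"
      by (intro mult_right_mono) auto
    moreover have "inner (g (x + t *\<^sub>R d) - g x) d \<le> norm (g (x + t *\<^sub>R d) - g x) * norm d"
      by (rule norm_cauchy_schwarz)
    ultimately show "inner (g (x + t *\<^sub>R d) - g x) d - L * t * (norm d)\<^sup>2 \<le> 0"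
      by (simp add: power2_eq_square algebra_simps)
  qed
  then show ?thesis by (simp add: \<phi>_def d_def)
qed

section \<open>One inexact projected gradient step\<close>

text \<open>Here \<open>p\<close> is the direction actually used at \<open>y\<close>, so \<open>p - g y\<close> is the gradient error. The projection
  makes the first-order change \<open>inner p (w - y)\<close> at most \<open>- \<parallel>w - y\<parallel>\<^sup>2 / \<tau>\<close>, which outweighs the term
  \<open>L/2 \<parallel>w - y\<parallel>\<^sup>2\<close> of the descent inequality when \<open>\<tau> < 2/L\<close>.\<close>

lemma projected_step_decrease:
  fixes J :: "real ^ 'n \<Rightarrow> real"
  assumes "closed \<Omega>" "convex \<Omega>" and C1: "C1_near \<Omega> J g" and lip: "L-lipschitz_on \<Omega> g"
    and y: "y \<in> \<Omega>" and \<tau>: "0 < \<tau>" and w: "w = closest_point \<Omega> (y - \<tau> *\<^sub>R p)"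
  shows "J w + (1 / \<tau> - L / 2) * (norm (w - y))\<^sup>2 \<le> J y + norm (p - g y) * norm (w - y)"
proof -
  have w_in: "w \<in> \<Omega>"
    unfolding w using y \<open>closed \<Omega>\<close> by (intro closest_point_in_set) auto
  have "inner (y - \<tau> *\<^sub>R p - w) (y - w) \<le> 0"
    unfolding w by (rule closest_point_dot) fact+
  then have "(norm (w - y))\<^sup>2 + \<tau> * inner p (w - y) \<le> 0"
    by (simp add: power2_norm_eq_inner inner_diff_left inner_diff_right inner_commute algebra_simps)
  then have "inner p (w - y) \<le> - (1 / \<tau>) * (norm (w - y))\<^sup>2"
    using \<tau> by (simp add: field_simps)
  moreover have "inner (g y) (w - y) - inner p (w - y) \<le> norm (p - g y) * norm (w - y)"
    using norm_cauchy_schwarz[of "g y - p" "w - y"]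
    by (simp add: inner_diff_left norm_minus_commute)
  moreover have "J w \<le> J y + inner (g y) (w - y) + L / 2 * (norm (w - y))\<^sup>2"
    by (rule descent_inequality) fact+
  ultimately show ?thesis by (simp add: algebra_simps)
qed

text \<open>If an inexact step barely moves, its result is nearly stationary, and strong monotonicity of the
  gradient converts near-stationarity into closeness to \<open>z\<close>: add the variational inequality of the
  projection, tested with \<open>z\<close>, to the optimality condition of \<open>z\<close>, tested with \<open>w\<close>.\<close>

lemma projected_step_error_bound:
  fixes J :: "real ^ 'n \<Rightarrow> real"
  assumes "\<Omega> \<noteq> {}" "closed \<Omega>" "convex \<Omega>"
    and sc: "strongly_convex_grad \<mu> \<Omega> J g" and lip: "L-lipschitz_on \<Omega> g"
    and z: "z \<in> stationary_points \<Omega> g"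
    and y: "y \<in> \<Omega>" and \<tau>: "0 < \<tau>" and w: "w = closest_point \<Omega> (y - \<tau> *\<^sub>R p)"
  shows "\<mu> * norm (w - z) \<le> (L + 1 / \<tau>) * norm (w - y) + norm (p - g y)"
proof (cases "w = z")
  case True
  moreover have "0 \<le> L" using lip by (rule lipschitz_on_nonneg)
  ultimately show ?thesis using \<tau> by simp
next
  case False
  have w_in: "w \<in> \<Omega>"
    unfolding w using assms(1,2) by (intro closest_point_in_set)
  have z_in: "z \<in> \<Omega>" and opt: "0 \<le> inner (g z) (w - z)"
    using stationary_point_optimality[OF assms(1-3) z] w_in by auto
  have "inner (y - \<tau> *\<^sub>R p - w) (z - w) \<le> 0"
    unfolding w by (rule closest_point_dot) fact+
  then have "\<tau> * inner p (w - z) \<le> inner (y - w) (w - z)"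
    by (simp add: inner_diff_left inner_diff_right algebra_simps)
  then have "inner p (w - z) \<le> inner ((1 / \<tau>) *\<^sub>R (y - w)) (w - z)"
    using \<tau> by (simp add: pos_le_divide_eq mult.commute flip: scaleR_diff_right)
  then have "inner (g w - g z) (w - z)
      \<le> inner ((g w - g y) + (g y - p) + (1 / \<tau>) *\<^sub>R (y - w)) (w - z)"
    using opt by (simp only: inner_add_left inner_diff_left)
  also have "\<dots> \<le> norm ((g w - g y) + (g y - p) + (1 / \<tau>) *\<^sub>R (y - w)) * norm (w - z)"
    by (rule norm_cauchy_schwarz)
  also have "\<dots> \<le> (norm (g w - g y) + norm (g y - p) + norm ((1 / \<tau>) *\<^sub>R (y - w))) * norm (w - z)"
    by (intro mult_right_mono norm_triangle_mono order_refl norm_ge_zero)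
  also have "\<dots> \<le> (L * norm (w - y) + norm (p - g y) + 1 / \<tau> * norm (w - y)) * norm (w - z)"
    using lipschitz_onD[OF lip w_in y] \<tau>
    by (intro mult_right_mono) (simp_all add: dist_norm norm_minus_commute)
  finally have "\<mu> * norm (w - z) * norm (w - z)
      \<le> ((L + 1 / \<tau>) * norm (w - y) + norm (p - g y)) * norm (w - z)"
    using strongly_convex_grad_monotone[OF sc w_in z_in]
    by (simp add: power2_eq_square algebra_simps)
  then show ?thesis
    using False by (simp add: mult_le_cancel_right)
qed

section \<open>Convergence\<close>

lemma summable_of_perturbed_descent:
  fixes a w \<epsilon> :: "nat \<Rightarrow> real"
  assumes "\<And>k. 0 \<le> w k" and "\<And>k. 0 \<le> \<epsilon> k" and "summable \<epsilon>" and "\<And>k. m \<le> a k"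
    and step: "\<And>k. a (Suc k) + w k \<le> a k + \<epsilon> k"
  shows "summable w"
proof (rule summableI_nonneg_bounded)
  fix n
  have "a n + sum w {..<n} \<le> a 0 + sum \<epsilon> {..<n}"
  proof (induction n)
    case (Suc n)
    then show ?case using step[of n] by simp
  qed simp
  moreover have "sum \<epsilon> {..<n} \<le> suminf \<epsilon>"
    using assms by (intro sum_le_suminf) auto
  ultimately show "sum w {..<n} \<le> a 0 + suminf \<epsilon> - m"
    using \<open>m \<le> a n\<close> by linarith
qed fact

theorem theorem4p1:
  fixes \<Omega> :: "(real ^ 'n) set"
    and J :: "real ^ 'n \<Rightarrow> real"
    and gradJ :: "real ^ 'n \<Rightarrow> real ^ 'n"
    and D :: "real ^ 'n \<Rightarrow> real ^ 'n ^ 'n"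
    and \<mu> L :: real
    and \<tau> \<beta> :: "nat \<Rightarrow> real"
    and v x :: "nat \<Rightarrow> real ^ 'n"
  assumes "\<Omega> \<noteq> {}" and "closed \<Omega>" and "convex \<Omega>" and "bounded \<Omega>"
    and "C1_near \<Omega> J gradJ"
    and "\<mu> > 0" and "strongly_convex_grad \<mu> \<Omega> J gradJ"
    and "L \<ge> \<mu>" and "L-lipschitz_on \<Omega> gradJ"
    and "\<exists>x\<^sub>\<Omega>\<in>\<Omega>. ereal (norm (gradJ x\<^sub>\<Omega>)) < \<infinity>"
    and "stationary_points \<Omega> gradJ \<noteq> {}"
    and "\<And>k. \<tau> k > 0"
    and "0 < (INF i. \<tau> i)"
    and "\<And>k. (INF i. \<tau> i) \<le> \<tau> k \<and> \<tau> k \<le> (SUP i. \<tau> i)"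
    and "(SUP i. \<tau> i) < 2 / L"
    and "constant_scaling D \<or> linear_scaling D"
    and "bounded (range v)"
    and "\<And>k. \<beta> k \<ge> 0" and "summable \<beta>"
    and "x 0 \<in> \<Omega>"
    and "\<And>k. x (Suc k) =
           closest_point \<Omega> ((x k + \<beta> k *\<^sub>R v k)
             - \<tau> k *\<^sub>R (D (x k + \<beta> k *\<^sub>R v k) *v gradJ (x k + \<beta> k *\<^sub>R v k)))"
    and "\<And>k. x k + \<beta> k *\<^sub>R v k \<in> \<Omega>"
    and "summable (\<lambda>k. norm (gradJ (x k) - D (x k) *v gradJ (x k)))"
  shows "\<exists>z\<in>stationary_points \<Omega> gradJ. x \<longlonglongrightarrow> z"
proof -
  let ?y = "\<lambda>k. x k + \<beta> k *\<^sub>R v k"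
  let ?p = "\<lambda>k. D (?y k) *v gradJ (?y k)"
  obtain z where z: "z \<in> stationary_points \<Omega> gradJ"
    using assms by blast
  note opt = stationary_point_optimality[OF assms(1-3) z]
  have y_in: "?y k \<in> \<Omega>" for k by fact
  have x_in: "x k \<in> \<Omega>" for k
  proof (cases k)
    case (Suc j)
    have "closest_point \<Omega> (?y j - \<tau> j *\<^sub>R ?p j) \<in> \<Omega>"
      using assms(1,2) by (intro closest_point_in_set)
    then show ?thesis using assms(21)[of j] by (simp add: Suc)
  qed (simp add: \<open>x 0 \<in> \<Omega>\<close>)
  have sc: "J a + inner (gradJ a) (b - a) \<le> J b" if "a \<in> \<Omega>" "b \<in> \<Omega>" for a b
  proof -
    have "J b \<ge> J a + inner (gradJ a) (b - a) + 1 / 2 * \<mu> * (norm (b - a))\<^sup>2"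
      using assms(7) that unfolding strongly_convex_grad_def by blast
    moreover have "0 \<le> 1 / 2 * \<mu> * (norm (b - a))\<^sup>2" using \<open>\<mu> > 0\<close> by simp
    ultimately show ?thesis by linarith
  qed

  obtain C where C: "C-lipschitz_on \<Omega> (\<lambda>x. D x *v gradJ x)"
    using scaled_map_lipschitz[OF assms(4,9,16)] by blast
  have "bounded (gradJ ` \<Omega>)"
    using assms(4,9)
    by (intro bounded_uniformly_continuous_image lipschitz_on_uniformly_continuous)
  then obtain G where G: "G > 0" "\<And>a. a \<in> \<Omega> \<Longrightarrow> norm (gradJ a) \<le> G"
    unfolding bounded_pos by blast
  obtain V where V: "V > 0" "\<And>k. norm (v k) \<le> V"
    using assms(17) unfolding bounded_pos by blast
  have shift: "norm (?y k - x k) \<le> \<beta> k * V" for k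
    using assms(18)[of k] V(2)[of k] by (simp add: mult_left_mono)

  \<comment> \<open>The gradient errors inherit summability from \<open>\<theta>\<close>: moving from \<open>x k\<close> to \<open>?y k\<close>
    changes \<open>a \<mapsto> D a *v gradJ a - gradJ a\<close> by \<open>O(\<beta> k)\<close>.\<close>
  define \<theta> where "\<theta> = (\<lambda>k. gradJ (x k) - D (x k) *v gradJ (x k))"
  have err: "norm (?p k - gradJ (?y k)) \<le> (C + L) * (\<beta> k * V) + norm (\<theta> k)" for k
  proof -
    have "?p k - gradJ (?y k)
        = (?p k - D (x k) *v gradJ (x k)) + (gradJ (x k) - gradJ (?y k)) + (- \<theta> k)"
      by (simp add: \<theta>_def)
    then have "norm (?p k - gradJ (?y k)) \<le>
        norm (?p k - D (x k) *v gradJ (x k)) + norm (gradJ (x k) - gradJ (?y k)) + norm (- \<theta> k)"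
      by (simp only:) (intro norm_triangle_mono order_refl)
    moreover have "norm (?p k - D (x k) *v gradJ (x k)) \<le> C * norm (?y k - x k)"
      using lipschitz_onD[OF C y_in x_in, of k k] by (simp only: dist_norm)
    moreover have "norm (gradJ (x k) - gradJ (?y k)) \<le> L * norm (?y k - x k)"
      using lipschitz_onD[OF assms(9) y_in x_in, of k k]
      by (simp only: dist_norm norm_minus_commute)
    moreover have "(C + L) * norm (?y k - x k) \<le> (C + L) * (\<beta> k * V)"
      using shift[of k] lipschitz_on_nonneg[OF C] lipschitz_on_nonneg[OF assms(9)]
      by (intro mult_left_mono) auto
    ultimately show ?thesis by (simp add: distrib_right)
  qed
  have "summable (\<lambda>k. (C + L) * (\<beta> k * V) + norm (\<theta> k))"
    using assms(19,23) unfolding \<theta>_def by (intro summable_add summable_mult summable_mult2)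
  then have err_sum: "summable (\<lambda>k. norm (?p k - gradJ (?y k)))"
    by (rule summable_comparison_test'[where N = 0]) (use err in simp)

  define T where "T = (SUP i. \<tau> i)"
  define c where "c = 1 / T - L / 2"
  have T: "0 < T" "\<tau> k \<le> T" for k
    using assms(12)[of k] assms(14)[of k] by (auto simp: T_def)
  have "0 < L" using assms(6,8) by simp
  then have "c > 0"
    using T(1) assms(15) unfolding c_def T_def[symmetric] by (simp add: field_simps)
  have c_le: "c \<le> 1 / \<tau> k - L / 2" for k
    using T(2)[of k] assms(12)[of k] by (simp add: c_def frac_le)

  obtain R where R: "\<And>a b. a \<in> \<Omega> \<Longrightarrow> b \<in> \<Omega> \<Longrightarrow> norm (a - b) \<le> R"
    using assms(4) diameter_bounded_bound[OF assms(4)] by (metis dist_norm)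
  have "0 \<le> R" using R[OF x_in x_in, of 0 0] by simp

  define \<epsilon> where "\<epsilon> = (\<lambda>k. norm (?p k - gradJ (?y k)) * R + G * (\<beta> k * V))"
  have decrease: "J (x (Suc k)) + c * (norm (x (Suc k) - ?y k))\<^sup>2 \<le> J (x k) + \<epsilon> k" for k
  proof -
    have "J (x (Suc k)) + (1 / \<tau> k - L / 2) * (norm (x (Suc k) - ?y k))\<^sup>2
        \<le> J (?y k) + norm (?p k - gradJ (?y k)) * norm (x (Suc k) - ?y k)"
      by (rule projected_step_decrease[OF assms(2,3,5,9) y_in assms(12)]) fact
    moreover have "c * (norm (x (Suc k) - ?y k))\<^sup>2
        \<le> (1 / \<tau> k - L / 2) * (norm (x (Suc k) - ?y k))\<^sup>2"
      using c_le by (intro mult_right_mono) auto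
    moreover have "norm (?p k - gradJ (?y k)) * norm (x (Suc k) - ?y k)
        \<le> norm (?p k - gradJ (?y k)) * R"
      using R[OF x_in y_in] by (intro mult_left_mono) auto
    \<comment> \<open>The gradient inequality bounds \<open>J (?y k) - J (x k)\<close> from above when taken at \<open>?y k\<close>.\<close>
    moreover have "J (?y k) \<le> J (x k) + inner (gradJ (?y k)) (?y k - x k)"
      using sc[OF y_in x_in, of k k] by (simp only: inner_diff_right)
    moreover have "inner (gradJ (?y k)) (?y k - x k) \<le> G * (\<beta> k * V)"
      using G y_in shift[of k]
      by (intro order_trans[OF norm_cauchy_schwarz] mult_mono) auto
    ultimately show ?thesis unfolding \<epsilon>_def by linarith
  qed
  have "summable (\<lambda>k. c * (norm (x (Suc k) - ?y k))\<^sup>2)"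
  proof (rule summable_of_perturbed_descent[where a = "\<lambda>k. J (x k)" and \<epsilon> = \<epsilon>])
    show "0 \<le> c * (norm (x (Suc k) - ?y k))\<^sup>2" for k using \<open>c > 0\<close> by simp
    show "0 \<le> \<epsilon> k" for k
      using \<open>0 \<le> R\<close> G V assms(18) by (simp add: \<epsilon>_def)
    show "summable \<epsilon>"
      unfolding \<epsilon>_def
      using err_sum assms(19) by (intro summable_add summable_mult summable_mult2)
    show "J z \<le> J (x k)" for k
      using sc[OF opt(1) x_in, of k] opt(2)[OF x_in, of k] by linarith
    show "J (x (Suc k)) + c * (norm (x (Suc k) - ?y k))\<^sup>2 \<le> J (x k) + \<epsilon> k" for k
      by (rule decrease)
  qed
  then have "(\<lambda>k. (norm (x (Suc k) - ?y k))\<^sup>2) \<longlonglongrightarrow> 0"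
    using \<open>c > 0\<close> by (intro summable_LIMSEQ_zero) (simp add: summable_cmult_iff)
  then have move: "(\<lambda>k. norm (x (Suc k) - ?y k)) \<longlonglongrightarrow> 0"
    using tendsto_real_sqrt by fastforce

  define t where "t = (INF i. \<tau> i)"
  have "(\<lambda>k. ((L + 1 / t) * norm (x (Suc k) - ?y k) + norm (?p k - gradJ (?y k))) / \<mu>)
      \<longlonglongrightarrow> ((L + 1 / t) * 0 + 0) / \<mu>"
    using \<open>\<mu> > 0\<close> by (intro tendsto_intros move summable_LIMSEQ_zero[OF err_sum]) auto
  then have lim: "(\<lambda>k. ((L + 1 / t) * norm (x (Suc k) - ?y k) + norm (?p k - gradJ (?y k))) / \<mu>)
      \<longlonglongrightarrow> 0"
    by simp
  have "norm (x (Suc k) - z)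
      \<le> ((L + 1 / t) * norm (x (Suc k) - ?y k) + norm (?p k - gradJ (?y k))) / \<mu>" for k
  proof -
    have "\<mu> * norm (x (Suc k) - z)
        \<le> (L + 1 / \<tau> k) * norm (x (Suc k) - ?y k) + norm (?p k - gradJ (?y k))"
      by (rule projected_step_error_bound[OF assms(1-3,7,9) z y_in assms(12)]) fact
    also have "\<dots> \<le> (L + 1 / t) * norm (x (Suc k) - ?y k) + norm (?p k - gradJ (?y k))"
      using assms(13) assms(14)[of k]
      by (intro add_right_mono mult_right_mono add_left_mono) (auto simp: t_def frac_le)
    finally show ?thesis using \<open>\<mu> > 0\<close> by (simp add: field_simps)
  qed
  then have "(\<lambda>k. norm (x (Suc k) - z)) \<longlonglongrightarrow> 0"
    by (intro tendsto_sandwich[OF _ _ tendsto_const lim]) auto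
  then have "(\<lambda>k. x (Suc k)) \<longlonglongrightarrow> z"
    by (simp add: LIM_zero_iff tendsto_norm_zero_iff)
  then show ?thesis
    using z by (auto simp: filterlim_sequentially_Suc)
qed

end
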